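(* Let $(X,\tau)$ be a $T_0$ space. Then the following conditions are equivalent: (1) $(X,\tau^s)$ is compact, where $\tau^s$ is the strong topology of $(X,\tau)$. (2) $(X,\tau)$ is both a Noetherian space and a co-Noetherian space. (3) $(X,\tau)$ is both a Noetherian space and a well-filtered space. (4) $(X,\tau)$ is both a Noetherian space and an open well-filtered space.
   Context: "Compact" means that every open cover has a finite subcover (no separation assumed). The strong topology $\tau^s$ of $(X,\tau)$ is the topology on $X$ having as a subbase the family of all $\tau$-open sets together with all $\tau$-closed sets. A space is Noetherian if all of its open sets are compact. A filtered family (filter basis) of sets is a nonempty family such that any two members contain a third member of the family. A space $(X,\tau)$ is co-Noetherian if for each open set $V$ and each filter basis $\mathcal{U}$ of open sets with $\bigcap\mathcal{U}\subseteq V$, there is a $U\in\mathcal{U}$ with $U\subseteq V$. A set is saturated if it is an intersection of open sets. A $T_0$ space is well-filtered if for each filtered family $\mathcal{C}$ of compact saturated sets and each open $U$, $\bigcap\mathcal{C}\subseteq U$ implies $K\subseteq U$ for some $K\in\mathcal{C}$. For open sets $U,V$, write $U\ll V$ if each open cover of $V$ has a finite subfamily covering $U$. A nonempty family $\mathcal{F}$ of open sets is $\ll$-filtered if for any $U_1,U_2\in\mathcal{F}$ there is $U_3\in\mathcal{F}$ with $U_3\ll U_1$ and $U_3\ll U_2$. A $T_0$ space is open well-filtered if for each $\ll$-filtered family $\mathcal{F}$ of open sets and each open $U$, $\bigcap\mathcal{F}\subseteq U$ implies $V\subseteq U$ for some $V\in\mathcal{F}$. *)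

theory Defs
  imports "HOL-Analysis.Analysis"
begin

definition strong_topology :: "'a topology \<Rightarrow> 'a topology" where
  "strong_topology X = topology_generated_by ({U. openin X U} \<union> {C. closedin X C})"

lemma topspace_strong_topology [simp]: "topspace (strong_topology X) = topspace X"
  unfolding strong_topology_def topology_generated_by_topspace
  by (auto dest: openin_subset closedin_subset)

definition noetherian_space :: "'a topology \<Rightarrow> bool" where
  "noetherian_space X \<longleftrightarrow> (\<forall>U. openin X U \<longrightarrow> compactin X U)"

text \<open>A filtered family of sets, also called a filter basis. It may contain the empty set.\<close>

definition filtered_family :: "'a set set \<Rightarrow> bool" where
  "filtered_family \<F> \<longleftrightarrow> \<F> \<noteq> {} \<and> (\<forall>A\<in>\<F>. \<forall>B\<in>\<F>. \<exists>C\<in>\<F>. C \<subseteq> A \<inter> B)"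

definition co_noetherian_space :: "'a topology \<Rightarrow> bool" where
  "co_noetherian_space X \<longleftrightarrow>
     (\<forall>V \<U>. openin X V \<and> filtered_family \<U> \<and> (\<forall>U\<in>\<U>. openin X U) \<and> \<Inter>\<U> \<subseteq> V
        \<longrightarrow> (\<exists>U\<in>\<U>. U \<subseteq> V))"

text \<open>Since \<open>\<Inter>{} = UNIV\<close> on the type level, the family is required to be nonempty.
  Nothing is lost: the intersection of no open sets, taken inside the space, is
  \<open>topspace X = \<Inter>{topspace X}\<close>.\<close>

definition saturatedin :: "'a topology \<Rightarrow> 'a set \<Rightarrow> bool" where
  "saturatedin X S \<longleftrightarrow> (\<exists>\<U>. \<U> \<noteq> {} \<and> (\<forall>U\<in>\<U>. openin X U) \<and> S = \<Inter>\<U>)"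

definition well_filtered_space :: "'a topology \<Rightarrow> bool" where
  "well_filtered_space X \<longleftrightarrow> t0_space X \<and>
     (\<forall>\<C> U. filtered_family \<C> \<and> (\<forall>K\<in>\<C>. compactin X K \<and> saturatedin X K) \<and>
        openin X U \<and> \<Inter>\<C> \<subseteq> U \<longrightarrow> (\<exists>K\<in>\<C>. K \<subseteq> U))"

definition way_below_open :: "'a topology \<Rightarrow> 'a set \<Rightarrow> 'a set \<Rightarrow> bool" where
  "way_below_open X U V \<longleftrightarrow> openin X U \<and> openin X V \<and>
     (\<forall>\<W>. (\<forall>W\<in>\<W>. openin X W) \<and> V \<subseteq> \<Union>\<W>
        \<longrightarrow> (\<exists>\<W>'. finite \<W>' \<and> \<W>' \<subseteq> \<W> \<and> U \<subseteq> \<Union>\<W>'))"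

definition way_below_filtered :: "'a topology \<Rightarrow> 'a set set \<Rightarrow> bool" where
  "way_below_filtered X \<F> \<longleftrightarrow> \<F> \<noteq> {} \<and> (\<forall>U\<in>\<F>. openin X U) \<and>
     (\<forall>U1\<in>\<F>. \<forall>U2\<in>\<F>. \<exists>U3\<in>\<F>. way_below_open X U3 U1 \<and> way_below_open X U3 U2)"

definition open_well_filtered_space :: "'a topology \<Rightarrow> bool" where
  "open_well_filtered_space X \<longleftrightarrow> t0_space X \<and>
     (\<forall>\<F> U. way_below_filtered X \<F> \<and> openin X U \<and> \<Inter>\<F> \<subseteq> U \<longrightarrow> (\<exists>V\<in>\<F>. V \<subseteq> U))"

end

theory Submission
  imports Defs
begin

text \<open>
  By Alexander's subbase lemma, compactness of the strong topology may be tested on covers by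
  open and closed sets. In such a cover, the complements of finite unions of the closed members
  form a filter basis of open sets whose intersection is contained in the union of the open
  members; co-Noetherianness picks one of these complements, and Noetherianness covers it by
  finitely many of the open members. Well-filteredness reduces to co-Noetherianness because the
  open neighbourhoods of the members of a filtered family of saturated sets form a filter basis
  with the same intersection. In a Noetherian space \<open>\<lless>\<close> is inclusion, so open well-filteredness
  is co-Noetherianness.
\<close>

text \<open>Alexander's lemma yields compactness of the topology \<open>Y\<close> of unions of
  finite intersections, taken relative to \<open>\<Union>\<B>\<close>. The generated topology has
  the same points and is coarser than or equal to \<open>Y\<close>, so compactness passes down to
  it.\<close>

lemma compact_space_topology_generated_by:
  assumes "\<And>\<C>. \<lbrakk>\<C> \<subseteq> \<B>; \<Union>\<C> = \<Union>\<B>\<rbrakk> \<Longrightarrow> \<exists>\<C>'. finite \<C>' \<and> \<C>' \<subseteq> \<C> \<and> \<Union>\<C>' = \<Union>\<B>"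
  shows "compact_space (topology_generated_by \<B>)"
proof -
  define Y where
    "Y = topology (arbitrary union_of (finite intersection_of (\<lambda>x. x \<in> \<B>) relative_to \<Union>\<B>))"
  have topY: "topspace Y = \<Union>\<B>"
    unfolding Y_def by simp
  have compY: "compact_space Y"
    by (rule Alexander_subbase[OF Y_def[symmetric]]) (use assms topY in auto)
  have basis: "openin Y B" if "B \<in> \<B>" for B
  proof -
    have "(finite intersection_of (\<lambda>x. x \<in> \<B>)) B"
      using that by (simp add: finite_intersection_of_inc)
    then have "(finite intersection_of (\<lambda>x. x \<in> \<B>) relative_to \<Union>\<B>) (\<Union>\<B> \<inter> B)"
      by (rule relative_to_inc)
    moreover have "\<Union>\<B> \<inter> B = B"
      using that by auto
    ultimately show ?thesis
      unfolding Y_def openin_subbase by (simp add: arbitrary_union_of_inc)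
  qed
  have "openin Y S" if "openin (topology_generated_by \<B>) S" for S
    using generate_topology_on_coarsest[of "openin Y" \<B> S] basis that
    by (simp add: openin_topology_generated_by)
  then show ?thesis
    using compY topY unfolding compact_space_def compactin_def topology_generated_by_topspace
    by simp
qed

lemma openin_strong_topology:
  "openin X U \<Longrightarrow> openin (strong_topology X) U"
  "closedin X U \<Longrightarrow> openin (strong_topology X) U"
  unfolding strong_topology_def by (simp_all add: topology_generated_by_Basis)

lemma closedin_strong_topology:
  "openin X U \<Longrightarrow> closedin (strong_topology X) U"
  unfolding closedin_def topspace_strong_topology
  by (simp add: openin_subset openin_strong_topology(2) closedin_diff)

lemma filtered_family_finite_lower_bound:
  assumes "filtered_family \<F>" "finite \<G>" "\<G> \<subseteq> \<F>"
  shows "\<exists>A\<in>\<F>. A \<subseteq> \<Inter>\<G>"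
  using assms(2,3)
proof (induction rule: finite_induct)
  case empty
  then show ?case
    using assms(1) by (auto simp: filtered_family_def)
next
  case (insert B \<G>)
  then obtain A where "A \<in> \<F>" "A \<subseteq> \<Inter>\<G>" "B \<in> \<F>"
    by auto
  then show ?case
    using assms(1) unfolding filtered_family_def by (metis Inter_insert le_inf_iff subset_trans)
qed

text \<open>An open set is strongly closed, hence strongly compact, and a cover by open sets is in
  particular a cover by strongly open ones.\<close>

lemma compact_strong_imp_noetherian:
  assumes "compact_space (strong_topology X)"
  shows "noetherian_space X"
  unfolding noetherian_space_def
proof (intro allI impI)
  fix U
  assume U: "openin X U"
  then have "compactin (strong_topology X) U"
    using assms closedin_compact_space closedin_strong_topology by blast
  then show "compactin X U"
    using U openin_strong_topology openin_subset unfolding compactin_def by metis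
qed

text \<open>By complementation: the complements of the members of the filter basis are strongly open
  and cover the strongly compact complement of \<open>V\<close>. A finite subcover names finitely
  many members, and the filter basis has a member below them all.\<close>

lemma compact_strong_imp_co_noetherian:
  assumes "compact_space (strong_topology X)"
  shows "co_noetherian_space X"
  unfolding co_noetherian_space_def
proof (intro allI impI, elim conjE)
  fix V \<U>
  assume V: "openin X V" and filt: "filtered_family \<U>" and op: "\<forall>U\<in>\<U>. openin X U"
    and sub: "\<Inter>\<U> \<subseteq> V"
  let ?c = "\<lambda>U. topspace X - U"
  have "closedin (strong_topology X) (topspace X - V)"
    using openin_strong_topology(1)[OF V] by (metis closedin_diff closedin_topspace
        topspace_strong_topology)
  then have "compactin (strong_topology X) (topspace X - V)"
    using assms closedin_compact_space by blast
  moreover have "\<forall>W\<in>?c ` \<U>. openin (strong_topology X) W"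
    using op openin_strong_topology(2) closedin_diff[OF closedin_topspace] by blast
  moreover have "topspace X - V \<subseteq> \<Union> (?c ` \<U>)"
    using sub by auto
  ultimately obtain \<F> where "finite \<F>" "\<F> \<subseteq> ?c ` \<U>" "topspace X - V \<subseteq> \<Union>\<F>"
    unfolding compactin_def by meson
  then obtain \<G> where \<G>: "finite \<G>" "\<G> \<subseteq> \<U>" "topspace X - V \<subseteq> \<Union> (?c ` \<G>)"
    by (metis finite_subset_image)
  obtain A where "A \<in> \<U>" "A \<subseteq> \<Inter>\<G>"
    using filtered_family_finite_lower_bound[OF filt \<G>(1,2)] by blast
  \<comment> \<open>Complements are taken inside the space, while \<open>\<Inter>\<G>\<close> is
    \<open>UNIV\<close> for empty \<open>\<G>\<close>; so \<open>A\<close> has to be located inside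
    \<open>topspace X\<close>.\<close>
  moreover have "A \<subseteq> topspace X"
    using op \<open>A \<in> \<U>\<close> openin_subset by blast
  moreover have "topspace X - V \<subseteq> topspace X - \<Inter>\<G>"
    using \<G>(3) by auto
  ultimately have "A \<subseteq> V"
    by blast
  then show "\<exists>U\<in>\<U>. U \<subseteq> V"
    using \<open>A \<in> \<U>\<close> by blast
qed

lemma noetherian_co_noetherian_imp_compact_strong:
  assumes "noetherian_space X" "co_noetherian_space X"
  shows "compact_space (strong_topology X)"
  unfolding strong_topology_def
proof (rule compact_space_topology_generated_by)
  let ?B = "{U. openin X U} \<union> {C. closedin X C}"
  have top: "\<Union>?B = topspace X"
    by (auto dest: openin_subset closedin_subset)
  fix \<C>
  assume \<C>: "\<C> \<subseteq> ?B" "\<Union>\<C> = \<Union>?B"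
  define \<O> where "\<O> = {U \<in> \<C>. openin X U}"
  define \<K> where "\<K> = {C \<in> \<C>. closedin X C}"
  define \<U> where "\<U> = {topspace X - \<Union>\<F> |\<F>. finite \<F> \<and> \<F> \<subseteq> \<K>}"
  have "\<Inter>\<U> \<subseteq> \<Union>\<O>"
  proof
    fix x
    assume x: "x \<in> \<Inter>\<U>"
    \<comment> \<open>The empty subfamily of \<open>\<K>\<close> contributes
      \<open>topspace X\<close>, which forces \<open>x\<close> into the space and hence into some
      member of the cover.\<close>
    have "topspace X - \<Union>{} \<in> \<U>"
      unfolding \<U>_def by blast
    then have "x \<in> \<Union>\<C>"
      using x \<C>(2) top by auto
    moreover have "x \<notin> C" if "C \<in> \<K>" for C
    proof -
      have "topspace X - \<Union>{C} \<in> \<U>"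
        unfolding \<U>_def using that by blast
      then show ?thesis
        using x by blast
    qed
    ultimately show "x \<in> \<Union>\<O>"
      using \<C>(1) unfolding \<O>_def \<K>_def by blast
  qed
  moreover have "filtered_family \<U>"
    unfolding filtered_family_def
  proof (intro conjI ballI)
    show "\<U> \<noteq> {}"
      unfolding \<U>_def by blast
    fix A B
    assume "A \<in> \<U>" "B \<in> \<U>"
    then obtain \<F> \<G> where "finite \<F>" "\<F> \<subseteq> \<K>" "A = topspace X - \<Union>\<F>"
      and "finite \<G>" "\<G> \<subseteq> \<K>" "B = topspace X - \<Union>\<G>"
      unfolding \<U>_def by blast
    then have "topspace X - \<Union>(\<F> \<union> \<G>) \<in> \<U>" "topspace X - \<Union>(\<F> \<union> \<G>) \<subseteq> A \<inter> B"
      unfolding \<U>_def by (blast intro: finite_UnI)+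
    then show "\<exists>C\<in>\<U>. C \<subseteq> A \<inter> B"
      by blast
  qed
  moreover have op\<U>: "\<forall>U\<in>\<U>. openin X U"
    unfolding \<U>_def \<K>_def by (blast intro: openin_diff closedin_Union)
  moreover have "openin X (\<Union>\<O>)"
    unfolding \<O>_def by blast
  ultimately obtain U where "U \<in> \<U>" "U \<subseteq> \<Union>\<O>"
    using assms(2) unfolding co_noetherian_space_def by meson
  then obtain \<F> where \<F>: "finite \<F>" "\<F> \<subseteq> \<K>" "topspace X - \<Union>\<F> \<subseteq> \<Union>\<O>"
    unfolding \<U>_def by blast
  have "compactin X (topspace X - \<Union>\<F>)"
    using assms(1) op\<U> \<F>(1,2) unfolding noetherian_space_def \<U>_def by blast
  moreover have "\<forall>W\<in>\<O>. openin X W"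
    unfolding \<O>_def by blast
  ultimately obtain \<G> where \<G>: "finite \<G>" "\<G> \<subseteq> \<O>" "topspace X - \<Union>\<F> \<subseteq> \<Union>\<G>"
    using \<F>(3) unfolding compactin_def by meson
  have sub: "\<F> \<union> \<G> \<subseteq> \<C>"
    using \<F>(2) \<G>(2) unfolding \<O>_def \<K>_def by blast
  then have "\<Union>(\<F> \<union> \<G>) = topspace X"
    using \<G>(3) \<C>(2) top by blast
  then show "\<exists>\<C>'. finite \<C>' \<and> \<C>' \<subseteq> \<C> \<and> \<Union>\<C>' = \<Union>?B"
    using \<F>(1) \<G>(1) sub top by (metis finite_UnI)
qed

lemma co_noetherian_imp_well_filtered:
  assumes "t0_space X" "co_noetherian_space X"
  shows "well_filtered_space X"
  unfolding well_filtered_space_def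
proof (intro conjI allI impI, fact, elim conjE)
  fix \<C> U
  assume filt: "filtered_family \<C>" and \<C>: "\<forall>K\<in>\<C>. compactin X K \<and> saturatedin X K"
    and U: "openin X U" and sub: "\<Inter>\<C> \<subseteq> U"
  define \<U> where "\<U> = {V. openin X V \<and> (\<exists>K\<in>\<C>. K \<subseteq> V)}"
  have "filtered_family \<U>"
    unfolding filtered_family_def
  proof (intro conjI ballI)
    obtain K where "K \<in> \<C>"
      using filt unfolding filtered_family_def by blast
    \<comment> \<open>A compact set lies inside the space, so the whole space is an open
      neighbourhood of \<open>K\<close>.\<close>
    then have "topspace X \<in> \<U>"
      unfolding \<U>_def using \<C> compactin_subset_topspace by blast
    then show "\<U> \<noteq> {}"
      by blast
    fix A B
    assume "A \<in> \<U>" "B \<in> \<U>"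
    then obtain K L where "openin X A" "openin X B" "K \<in> \<C>" "K \<subseteq> A" "L \<in> \<C>" "L \<subseteq> B"
      unfolding \<U>_def by blast
    moreover obtain M where "M \<in> \<C>" "M \<subseteq> K \<inter> L"
      using filt \<open>K \<in> \<C>\<close> \<open>L \<in> \<C>\<close> unfolding filtered_family_def by blast
    ultimately have "A \<inter> B \<in> \<U>"
      unfolding \<U>_def by blast
    then show "\<exists>C\<in>\<U>. C \<subseteq> A \<inter> B"
      by blast
  qed
  moreover have "\<Inter>\<U> \<subseteq> \<Inter>\<C>"
  proof (rule Inter_greatest)
    fix K
    assume "K \<in> \<C>"
    then obtain \<V> where "\<forall>V\<in>\<V>. openin X V" "K = \<Inter>\<V>"
      using \<C> unfolding saturatedin_def by meson
    \<comment> \<open>Each open set in a representation of the saturated set \<open>K\<close> is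
      itself a neighbourhood of \<open>K\<close>.\<close>
    then have "\<V> \<subseteq> \<U>"
      unfolding \<U>_def using \<open>K \<in> \<C>\<close> by blast
    then show "\<Inter>\<U> \<subseteq> K"
      using \<open>K = \<Inter>\<V>\<close> by blast
  qed
  moreover have "\<forall>V\<in>\<U>. openin X V"
    unfolding \<U>_def by blast
  ultimately obtain V where "V \<in> \<U>" "V \<subseteq> U"
    using assms(2) U sub unfolding co_noetherian_space_def by (meson subset_trans)
  then show "\<exists>K\<in>\<C>. K \<subseteq> U"
    unfolding \<U>_def by blast
qed

lemma openin_imp_saturatedin: "openin X U \<Longrightarrow> saturatedin X U"
  unfolding saturatedin_def by (rule exI[of _ "{U}"]) simp

text \<open>Open sets are saturated, and compact by Noetherianness, so well-filteredness applies
  directly to filter bases of open sets.\<close>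

lemma noetherian_well_filtered_imp_co_noetherian:
  assumes "noetherian_space X" "well_filtered_space X"
  shows "co_noetherian_space X"
  unfolding co_noetherian_space_def
proof (intro allI impI, elim conjE)
  fix V \<U>
  assume "openin X V" "filtered_family \<U>" "\<forall>U\<in>\<U>. openin X U" "\<Inter>\<U> \<subseteq> V"
  moreover have "\<forall>U\<in>\<U>. compactin X U \<and> saturatedin X U"
    using assms(1) \<open>\<forall>U\<in>\<U>. openin X U\<close> openin_imp_saturatedin
    unfolding noetherian_space_def by blast
  ultimately show "\<exists>U\<in>\<U>. U \<subseteq> V"
    using assms(2) unfolding well_filtered_space_def by simp
qed

text \<open>Forwards, \<open>V\<close> is covered by \<open>{V}\<close>, and any subfamily of it has
  union inside \<open>V\<close>. Backwards, a cover of \<open>V\<close> also covers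
  \<open>U\<close>, which is compact.\<close>

lemma noetherian_way_below_open_iff:
  assumes "noetherian_space X"
  shows "way_below_open X U V \<longleftrightarrow> openin X U \<and> openin X V \<and> U \<subseteq> V"
proof
  assume wb: "way_below_open X U V"
  then have op: "openin X U" "openin X V"
    and cover: "\<And>\<W>. \<lbrakk>\<forall>W\<in>\<W>. openin X W; V \<subseteq> \<Union>\<W>\<rbrakk>
      \<Longrightarrow> \<exists>\<W>'. finite \<W>' \<and> \<W>' \<subseteq> \<W> \<and> U \<subseteq> \<Union>\<W>'"
    unfolding way_below_open_def by simp_all
  obtain \<W> where "\<W> \<subseteq> {V}" "U \<subseteq> \<Union>\<W>"
    using cover[of "{V}"] op(2) by auto
  then show "openin X U \<and> openin X V \<and> U \<subseteq> V"
    using op by blast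
next
  assume UV: "openin X U \<and> openin X V \<and> U \<subseteq> V"
  then have "compactin X U"
    using assms unfolding noetherian_space_def by blast
  then show "way_below_open X U V"
    using UV unfolding way_below_open_def compactin_def by (meson subset_trans)
qed

lemma noetherian_way_below_filtered_iff:
  assumes "noetherian_space X"
  shows "way_below_filtered X \<F> \<longleftrightarrow> filtered_family \<F> \<and> (\<forall>U\<in>\<F>. openin X U)"
proof -
  have iff: "way_below_open X A B \<longleftrightarrow> A \<subseteq> B"
    if "\<forall>U\<in>\<F>. openin X U" "A \<in> \<F>" "B \<in> \<F>" for A B
    using that by (simp add: noetherian_way_below_open_iff[OF assms])
  show ?thesis
  \<comment> \<open>The relation becomes inclusion only between open sets; if some member is not
    open, both sides are false.\<close>
  proof (cases "\<forall>U\<in>\<F>. openin X U")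
    case True
    then show ?thesis
      by (simp add: iff way_below_filtered_def filtered_family_def cong: ball_cong bex_cong)
  next
    case False
    then show ?thesis
      by (simp only: way_below_filtered_def simp_thms)
  qed
qed

lemma noetherian_open_well_filtered_iff:
  assumes "noetherian_space X"
  shows "open_well_filtered_space X \<longleftrightarrow> t0_space X \<and> co_noetherian_space X"
proof -
  have "(way_below_filtered X \<F> \<and> openin X U \<and> \<Inter>\<F> \<subseteq> U) \<longleftrightarrow>
      (openin X U \<and> filtered_family \<F> \<and> (\<forall>V\<in>\<F>. openin X V) \<and> \<Inter>\<F> \<subseteq> U)" for \<F> U
    using noetherian_way_below_filtered_iff[OF assms, of \<F>] by argo
  then show ?thesis
    unfolding open_well_filtered_space_def co_noetherian_space_def by (simp only:) blast
qed

theorem corollary4p9: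
  fixes X :: "'a topology"
  assumes "t0_space X"
  shows "(compact_space (strong_topology X) \<longleftrightarrow> noetherian_space X \<and> co_noetherian_space X)
    \<and> (noetherian_space X \<and> co_noetherian_space X
        \<longleftrightarrow> noetherian_space X \<and> well_filtered_space X)
    \<and> (noetherian_space X \<and> well_filtered_space X
        \<longleftrightarrow> noetherian_space X \<and> open_well_filtered_space X)"
proof -
  have "compact_space (strong_topology X) \<longleftrightarrow> noetherian_space X \<and> co_noetherian_space X"
    using compact_strong_imp_noetherian compact_strong_imp_co_noetherian
      noetherian_co_noetherian_imp_compact_strong by metis
  \<comment> \<open>Co-Noetherianness is the hub: both filteredness conditions are compared with it
    under the Noetherian hypothesis, which every condition in the last two equivalences
    contains.\<close>
  moreover have "co_noetherian_space X \<longleftrightarrow> well_filtered_space X" if "noetherian_space X"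
    using that assms co_noetherian_imp_well_filtered noetherian_well_filtered_imp_co_noetherian
    by metis
  moreover have "open_well_filtered_space X \<longleftrightarrow> co_noetherian_space X" if "noetherian_space X"
    using noetherian_open_well_filtered_iff[OF that] assms by simp
  ultimately show ?thesis
    by argo
qed

end
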